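(* For any star $S$ and any $n$-vertex tree $T$, $$\mathrm{gm}(S\mathbin{\Box} T) \leq \mathrm{gm}(S \boxtimes T) \leq \mathrm{gm}(S\cdot T) <\sqrt{3n+1}+1.$$
   Context: For a graph $G$, $\mathrm{gm}(G)$ is the maximum integer $k$ such that the $k\times k$ grid is a minor of $G$. $G_1\mathbin{\Box} G_2$ is the Cartesian product, $G_1\boxtimes G_2$ the strong product, and $G_1\cdot G_2$ denotes the lexicographic product: vertex set $V(G_1)\times V(G_2)$, where distinct $(u_1,u_2),(v_1,v_2)$ are adjacent iff $u_1v_1\in E(G_1)$, or $u_1=v_1$ and $u_2v_2\in E(G_2)$. *)

theory Defs
  imports Complex_Main "Graph_Theory.Graph_Theory"
begin

text \<open>
  Graphs are finite and simple: \<^locale>\<open>pair_graph\<close> describes a finite, loop-free, symmetric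
  digraph whose arcs are pairs, so an undirected edge \<open>uv\<close> is present iff both
  \<open>(u, v)\<close> and \<open>(v, u)\<close> are arcs.
\<close>

text \<open>The star with \<open>m\<close> leaves, \<open>m \<ge> 0\<close>; the one-vertex graph is included.\<close>

definition star :: "'a pair_pre_digraph \<Rightarrow> bool" where
  "star S \<longleftrightarrow> pair_graph S \<and>
     (\<exists>c \<in> pverts S. parcs S = {c} \<times> (pverts S - {c}) \<union> (pverts S - {c}) \<times> {c})"

text \<open>
  \<^const>\<open>Digraph_Component.tree\<close> is not used: it forbids all directed cycles, hence also
  the closed walk \<open>u, v, u\<close> along an undirected edge. In a symmetric loop-free digraph, the cycles
  of the undirected graph are exactly the directed cycles of length at least 3.
  Connectedness includes being nonempty.
\<close>

definition undirected_tree :: "'a pair_pre_digraph \<Rightarrow> bool" where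
  "undirected_tree T \<longleftrightarrow> pair_graph T \<and> Digraph_Component.connected (with_proj T) \<and>
     \<not> (\<exists>p. pre_digraph.cycle (with_proj T) p \<and> length p \<ge> 3)"

definition cartesian_product ::
    "'a pair_pre_digraph \<Rightarrow> 'b pair_pre_digraph \<Rightarrow> ('a \<times> 'b) pair_pre_digraph" where
  "cartesian_product G H = \<lparr> pverts = pverts G \<times> pverts H,
     parcs = {((u1, u2), (v1, v2)).
        u1 = v1 \<and> u1 \<in> pverts G \<and> (u2, v2) \<in> parcs H \<or>
        (u1, v1) \<in> parcs G \<and> u2 = v2 \<and> u2 \<in> pverts H} \<rparr>"

definition strong_product ::
    "'a pair_pre_digraph \<Rightarrow> 'b pair_pre_digraph \<Rightarrow> ('a \<times> 'b) pair_pre_digraph" where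
  "strong_product G H = \<lparr> pverts = pverts G \<times> pverts H,
     parcs = {((u1, u2), (v1, v2)).
        u1 = v1 \<and> u1 \<in> pverts G \<and> (u2, v2) \<in> parcs H \<or>
        (u1, v1) \<in> parcs G \<and> u2 = v2 \<and> u2 \<in> pverts H \<or>
        (u1, v1) \<in> parcs G \<and> (u2, v2) \<in> parcs H} \<rparr>"

definition lexicographic_product ::
    "'a pair_pre_digraph \<Rightarrow> 'b pair_pre_digraph \<Rightarrow> ('a \<times> 'b) pair_pre_digraph" where
  "lexicographic_product G H = \<lparr> pverts = pverts G \<times> pverts H,
     parcs = {((u1, u2), (v1, v2)).
        (u1, v1) \<in> parcs G \<and> u2 \<in> pverts H \<and> v2 \<in> pverts H \<or>
        u1 = v1 \<and> u1 \<in> pverts G \<and> (u2, v2) \<in> parcs H} \<rparr>"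

definition path_graph :: "nat \<Rightarrow> nat pair_pre_digraph" where
  "path_graph k = \<lparr> pverts = {..<k}, parcs = {(i, j). i < k \<and> j < k \<and> (j = Suc i \<or> i = Suc j)} \<rparr>"

definition grid :: "nat \<Rightarrow> (nat \<times> nat) pair_pre_digraph" where
  "grid k = cartesian_product (path_graph k) (path_graph k)"

text \<open>
  \<open>B\<close> assigns to the vertices of \<open>H\<close> pairwise disjoint branch sets in \<open>G\<close>, each inducing a
  connected (in particular nonempty) subgraph; contracting each branch set to a vertex yields a
  graph that contains \<open>H\<close>.
\<close>

definition minor_model ::
    "'a pair_pre_digraph \<Rightarrow> 'b pair_pre_digraph \<Rightarrow> ('a \<Rightarrow> 'b set) \<Rightarrow> bool" where
  "minor_model H G B \<longleftrightarrow>
     (\<forall>x \<in> pverts H. B x \<subseteq> pverts G \<and>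
        Digraph_Component.connected (with_proj G \<restriction> B x)) \<and>
     (\<forall>x \<in> pverts H. \<forall>y \<in> pverts H. x \<noteq> y \<longrightarrow> B x \<inter> B y = {}) \<and>
     (\<forall>(x, y) \<in> parcs H. \<exists>u \<in> B x. \<exists>v \<in> B y. (u, v) \<in> parcs G)"

definition is_minor :: "'a pair_pre_digraph \<Rightarrow> 'b pair_pre_digraph \<Rightarrow> bool" where
  "is_minor H G \<longleftrightarrow> (\<exists>B. minor_model H G B)"

definition gm :: "'a pair_pre_digraph \<Rightarrow> nat" where
  "gm G = Max {k. is_minor (grid k) G}"

lemma pair_graph_iff:
  "pair_graph G \<longleftrightarrow> finite (pverts G) \<and> parcs G \<subseteq> pverts G \<times> pverts G \<and>
     sym (parcs G) \<and> irrefl (parcs G)" (is "?L \<longleftrightarrow> ?R")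
proof
  assume ?L
  then interpret pair_graph G .
  have "parcs G \<subseteq> pverts G \<times> pverts G"
    by (rule subrelI) (metis SigmaI arc_fst_in_verts arc_snd_in_verts fst_conv snd_conv)
  moreover have "sym (parcs G)" using pair_sym_arcs by (simp add: symmetric_def)
  moreover have "irrefl (parcs G)" by (metis fst_conv snd_conv irrefl_def pair_no_loops)
  ultimately show ?R using pair_finite_verts by simp
next
  assume R: ?R
  then have fin: "finite (parcs G)" by (meson finite_SigmaI finite_subset)
  show ?L
  proof
    show "finite (pverts G)" "finite (parcs G)" using R fin by simp_all
    show "symmetric (with_proj G)" using R by (simp add: symmetric_def)
    show "fst e \<in> pverts G" "snd e \<in> pverts G" "fst e \<noteq> snd e" if "e \<in> parcs G" for e
      using R that unfolding irrefl_def by (cases e; auto)+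
  qed
qed

lemma pair_graph_cartesian_product:
  "pair_graph G \<Longrightarrow> pair_graph H \<Longrightarrow> pair_graph (cartesian_product G H)"
  by (auto simp: pair_graph_iff cartesian_product_def intro!: symI irreflI
      dest: symD irreflD)

lemma pair_graph_strong_product:
  "pair_graph G \<Longrightarrow> pair_graph H \<Longrightarrow> pair_graph (strong_product G H)"
  by (auto simp: pair_graph_iff strong_product_def intro!: symI irreflI
      dest: symD irreflD)

lemma pair_graph_lexicographic_product:
  "pair_graph G \<Longrightarrow> pair_graph H \<Longrightarrow> pair_graph (lexicographic_product G H)"
  by (auto simp: pair_graph_iff lexicographic_product_def intro!: symI irreflI
      dest: symD irreflD)

lemma pair_graph_grid: "pair_graph (grid k)"
  unfolding grid_def
  by (rule pair_graph_cartesian_product)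
     (auto simp: pair_graph_iff path_graph_def intro!: symI irreflI)

lemma minor_model_nonempty:
  "minor_model H G B \<Longrightarrow> x \<in> pverts H \<Longrightarrow> B x \<noteq> {}"
  by (auto simp: minor_model_def Digraph_Component.connected_def strongly_connected_def
      mk_symmetric_def)

lemma is_minor_card_le:
  assumes "is_minor H G" "finite (pverts G)"
  shows "card (pverts H) \<le> card (pverts G)"
proof -
  obtain B where B: "minor_model H G B" using assms(1) by (auto simp: is_minor_def)
  define f where "f x = (SOME v. v \<in> B x)" for x
  have f: "f x \<in> B x" if "x \<in> pverts H" for x
    using minor_model_nonempty[OF B that] by (auto simp: f_def some_in_eq)
  have disj: "B x \<inter> B y = {}" if "x \<in> pverts H" "y \<in> pverts H" "x \<noteq> y" for x y
    using B that by (simp add: minor_model_def)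
  have sub: "B x \<subseteq> pverts G" if "x \<in> pverts H" for x
    using B that by (simp add: minor_model_def)
  have "inj_on f (pverts H)"
  proof (rule inj_onI, rule ccontr)
    fix x y assume xy: "x \<in> pverts H" "y \<in> pverts H" "f x = f y" "x \<noteq> y"
    with disj[OF xy(1,2,4)] f[OF xy(1)] f[OF xy(2)] show False by (metis IntI emptyE)
  qed
  moreover have "f ` pverts H \<subseteq> pverts G" using f sub by (metis image_subsetI subsetD)
  ultimately show ?thesis using assms(2) by (rule card_inj_on_le)
qed

text \<open>For finite \<open>G\<close> the maximum defining \<^const>\<open>gm\<close> exists.\<close>

lemma finite_grid_minors:
  assumes "finite (pverts G)"
  shows "finite {k. is_minor (grid k) G}"
proof (rule finite_subset)
  show "{k. is_minor (grid k) G} \<subseteq> {..card (pverts G)}"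
  proof
    fix k assume "k \<in> {k. is_minor (grid k) G}"
    then have "k * k \<le> card (pverts G)"
      using is_minor_card_le[OF _ assms, of "grid k"]
      by (simp add: grid_def cartesian_product_def path_graph_def card_cartesian_product)
    then show "k \<in> {..card (pverts G)}"
      using order_trans[OF le_square[of k]] by blast
  qed
qed simp

lemma is_minor_grid_0: "is_minor (grid 0) G"
  by (auto simp: is_minor_def minor_model_def grid_def cartesian_product_def path_graph_def)

lemma is_minor_grid_gm:
  "finite (pverts G) \<Longrightarrow> is_minor (grid (gm G)) G"
  using Max_in[OF finite_grid_minors[of G]] is_minor_grid_0[of G] by (auto simp: gm_def)

lemma gm_ge:
  "finite (pverts G) \<Longrightarrow> is_minor (grid k) G \<Longrightarrow> k \<le> gm G"
  by (simp add: gm_def finite_grid_minors)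

end

theory Submission
  imports Defs
begin

text \<open>
  Let \<open>c\<close> be the centre of \<open>S\<close>. At most \<open>n\<close> branch sets of a \<open>k \<times> k\<close> grid model in the
  lexicographic product meet the copy of \<open>T\<close> at \<open>c\<close>. The others live in the
  disjoint copies of \<open>T\<close> at the leaves, so the grid minus a set \<open>X\<close> of at most \<open>n\<close> vertices is
  a minor of a forest and, unless empty, has fewer edges than vertices. As \<open>X\<close> meets at most \<open>4 |X|\<close> of the
  \<open>2 k (k - 1)\<close> grid edges, \<open>2 k (k - 1) - 4 |X| < k\<^sup>2 - |X|\<close>, which gives
  \<open>(k - 1)\<^sup>2 \<le> 3 |X| \<le> 3 n\<close>. In the formal counts every edge
  contributes two arcs.
\<close>

section \<open>Arc counts of connected graphs and of forests\<close>

text \<open>Connectedness refers to the symmetric closure of the arcs, which adds nothing when they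
  are already symmetric. Later arguments can then induct on reachability inside
  \<open>B\<close>.\<close>

lemma connected_induce_subgraph_iff:
  assumes "sym (parcs G)"
  shows "Digraph_Component.connected (with_proj G \<restriction> B) \<longleftrightarrow>
    B \<noteq> {} \<and> (\<forall>u\<in>B. \<forall>v\<in>B. (u, v) \<in> rtrancl_on B (parcs G \<inter> B \<times> B))"
proof -
  have "parcs (mk_symmetric (with_proj G \<restriction> B)) = parcs G \<inter> B \<times> B"
    using assms by (auto simp: parcs_mk_symmetric dest: symD)
  then show ?thesis
    by (auto simp: Digraph_Component.connected_def strongly_connected_def reachable_def
        arcs_ends_conv)
qed

text \<open>If no arc of \<open>B\<close> left \<open>W\<close>, reachability inside
  \<open>B\<close> from a point of \<open>W\<close> would stay in \<open>W\<close>, forcing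
  \<open>W = B\<close>.\<close>

lemma connected_induce_subgraph_exit_arc:
  assumes "sym (parcs G)" "Digraph_Component.connected (with_proj G \<restriction> B)"
    and "W \<subseteq> B" "W \<noteq> {}" "W \<noteq> B"
  shows "\<exists>u\<in>W. \<exists>v\<in>B - W. (u, v) \<in> parcs G"
proof (rule ccontr)
  assume no: "\<not> ?thesis"
  obtain a where a: "a \<in> W" using assms(4) by blast
  have "b \<in> W" if "(a, b) \<in> rtrancl_on B (parcs G \<inter> B \<times> B)" for b
    using that by (induct rule: rtrancl_on_induct) (use a no in auto)
  then have "B \<subseteq> W" using assms(1-3) a by (auto simp: connected_induce_subgraph_iff)
  then show False using assms(3,5) by blast
qed

text \<open>This is the spanning tree bound of |B| - 1 edges, counted in arcs and with
  \<open>+ 2\<close> on the right instead of a subtraction. A set is grown from one vertex; each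
  exit arc adds one vertex and, with its reverse, two arcs.\<close>

lemma connected_card_arcs_ge:
  assumes sym: "sym (parcs G)" and conn: "Digraph_Component.connected (with_proj G \<restriction> B)"
    and fin: "finite B"
  shows "2 * card B \<le> card (parcs G \<inter> B \<times> B) + 2"
proof -
  let ?A = "\<lambda>W. parcs G \<inter> W \<times> W"
  \<comment> \<open>Only the count is carried along, not connectedness of \<open>W\<close>: the exit
    arc comes from connectedness of \<open>B\<close>.\<close>
  have "\<exists>W\<subseteq>B. card W = m \<and> 2 * card W \<le> card (?A W) + 2"
    if "1 \<le> m" "m \<le> card B" for m
    using that
  proof (induction m rule: dec_induct)
    case base
    obtain a where "a \<in> B"
      using conn sym by (auto simp: connected_induce_subgraph_iff)
    then show ?case by (intro exI[of _ "{a}"]) auto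
  next
    case (step m)
    then obtain W where W: "W \<subseteq> B" "card W = m" "2 * card W \<le> card (?A W) + 2" by auto
    have finW: "finite W" using W fin finite_subset by blast
    have "W \<noteq> {}" "W \<noteq> B" using W step by auto
    then obtain u v where uv: "u \<in> W" "v \<in> B" "v \<notin> W" "(u, v) \<in> parcs G"
      using connected_induce_subgraph_exit_arc[OF sym conn W(1)] by blast
    have "card {(u, v), (v, u)} = 2" using uv by (auto simp: card_2_iff)
    then have "card (?A W) + 2 = card (?A W \<union> {(u, v), (v, u)})"
      using uv finW by (subst card_Un_disjoint) auto
    also have "\<dots> \<le> card (?A (insert v W))"
      using uv sym finW by (intro card_mono) (auto dest: symD)
    finally show ?case
      using W uv finW by (intro exI[of _ "insert v W"]) auto
  qed
  moreover have "1 \<le> card B"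
    using conn sym fin by (auto simp: connected_induce_subgraph_iff Suc_le_eq card_gt_0_iff)
  ultimately obtain W where "W \<subseteq> B" "card W = card B" "2 * card W \<le> card (?A W) + 2"
    by blast
  then show ?thesis using card_subset_eq[OF fin] by metis
qed

text \<open>Paths are built below as vertex lists, whereas cycles are lists of arcs; this lemma and
  the next translate between them.\<close>

lemma pcas_vwalk_arcs: "xs \<noteq> [] \<Longrightarrow> pcas (hd xs) (vwalk_arcs xs) (last xs)"
  by (induct xs rule: vwalk_arcs.induct) auto

lemma pawalk_verts_vwalk_arcs: "xs \<noteq> [] \<Longrightarrow> pawalk_verts (hd xs) (vwalk_arcs xs) = xs"
  by (induct xs rule: vwalk_arcs.induct) auto

text \<open>Suppose every vertex has two neighbours in \<open>U\<close>, and take a longest path in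
  \<open>U\<close>. By maximality all neighbours of its first vertex lie on it; one that is not the
  second vertex closes a cycle.\<close>

lemma acyclic_ex_leaf:
  assumes T: "pair_graph T"
    and acyclic: "\<not> (\<exists>p. pre_digraph.cycle (with_proj T) p \<and> length p \<ge> 3)"
    and U: "U \<subseteq> pverts T" "U \<noteq> {}"
  shows "\<exists>u\<in>U. card {v\<in>U. (u, v) \<in> parcs T} \<le> 1"
proof (rule ccontr)
  assume "\<not> ?thesis"
  then have deg: "2 \<le> card {v\<in>U. (u, v) \<in> parcs T}" if "u \<in> U" for u
    using that by force
  interpret pair_graph T by fact
  have sym: "sym (parcs T)" and irrefl: "irrefl (parcs T)"
    using T by (auto simp: pair_graph_iff)
  have finU: "finite U" by (rule finite_subset[OF U(1) pair_finite_verts])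
  define P where "P xs \<longleftrightarrow>
    xs \<noteq> [] \<and> distinct xs \<and> set xs \<subseteq> U \<and> set (vwalk_arcs xs) \<subseteq> parcs T" for xs
  have "\<forall>xs. P xs \<longrightarrow> length xs < Suc (card U)"
    using finU by (auto simp: P_def less_Suc_eq_le card_mono simp flip: distinct_card)
  moreover obtain a where "a \<in> U" using U by blast
  then have "P [a]" by (simp add: P_def)
  ultimately obtain xs where xs: "P xs" and max: "\<And>ys. P ys \<Longrightarrow> length ys \<le> length xs"
    using ex_has_greatest_nat[of P "[a]" length] by blast
  define u where "u = hd xs"
  then obtain xs' where xs': "xs = u # xs'" using xs by (cases xs) (auto simp: P_def)
  have nbrs: "v \<in> set xs" if "v \<in> U" "(u, v) \<in> parcs T" for v
  proof (rule ccontr)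
    assume "v \<notin> set xs"
    then have "P (v # xs)" using xs that sym by (auto simp: P_def u_def dest: symD)
    then show False using max by force
  qed
  have "u \<in> U" using xs xs' by (auto simp: P_def)
  \<comment> \<open>Here \<open>hd xs'\<close> is the second vertex of the path. If
    \<open>xs'\<close> is empty it is an arbitrary value, which does no harm: two neighbours never
    fit into a singleton.\<close>
  have "\<not> {v\<in>U. (u, v) \<in> parcs T} \<subseteq> {hd xs'}"
  proof
    assume "{v\<in>U. (u, v) \<in> parcs T} \<subseteq> {hd xs'}"
    then have "card {v\<in>U. (u, v) \<in> parcs T} \<le> card {hd xs'}" by (intro card_mono) auto
    then show False using deg[OF \<open>u \<in> U\<close>] by simp
  qed
  then obtain v where v: "v \<in> U" "(u, v) \<in> parcs T" "v \<noteq> hd xs'" by auto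
  have "v \<noteq> u" using v irrefl by (auto simp: irrefl_def)
  then have "v \<in> set xs'" using nbrs[OF v(1,2)] xs' by auto
  then obtain ys zs where split: "xs' = ys @ v # zs" by (meson split_list)
  \<comment> \<open>A vertex strictly between \<open>u\<close> and \<open>v\<close> makes the closed
    walk have length at least 3, ruling out the degenerate walk along one edge and back.\<close>
  then have "ys \<noteq> []" using v by auto
  define ws where "ws = u # ys @ [v]"
  have ws: "ws \<noteq> []" "hd ws = u" "last ws = v" "distinct ws" "xs = ws @ zs"
    using xs xs' split by (auto simp: ws_def P_def)
  have "set (vwalk_arcs ws) \<subseteq> parcs T"
    using xs set_vwalk_arcs_append1[of ws zs] ws by (auto simp: P_def)
  then have "awalk v ((v, u) # vwalk_arcs ws) v"
    using pcas_vwalk_arcs[of ws] ws v U sym by (auto simp: awalk_def dest: symD)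
  then have "cycle ((v, u) # vwalk_arcs ws)"
    using pawalk_verts_vwalk_arcs[of ws] ws by (auto simp: cycle_def)
  moreover have "length ((v, u) # vwalk_arcs ws) \<ge> 3"
    using vwalk_length_simp[of ws] \<open>ys \<noteq> []\<close> by (cases ys) (auto simp: vwalk_length_def ws_def)
  ultimately show False using acyclic by blast
qed

text \<open>Deleting a leaf removes one vertex and at most two arcs. The leaf hypothesis ranges over
  all nonempty subsets so that it survives the deletion.\<close>

lemma card_arcs_le_if_leaves:
  assumes sym: "sym R" and irrefl: "irrefl R" and "finite U" "U \<noteq> {}"
    and leaf: "\<And>W. W \<subseteq> U \<Longrightarrow> W \<noteq> {} \<Longrightarrow> \<exists>u\<in>W. card {v\<in>W. (u, v) \<in> R} \<le> 1"
  shows "card (R \<inter> U \<times> U) + 2 \<le> 2 * card U"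
  using assms(3-5)
proof (induction "card U" arbitrary: U)
  case 0
  then show ?case by simp
next
  case (Suc m)
  obtain u where u: "u \<in> U" "card {v\<in>U. (u, v) \<in> R} \<le> 1" using Suc.prems by blast
  let ?W = "U - {u}" and ?N = "{v\<in>U. (u, v) \<in> R}"
  have split: "R \<inter> U \<times> U \<subseteq> (R \<inter> ?W \<times> ?W) \<union> ({u} \<times> ?N \<union> ?N \<times> {u})"
    using sym by (auto dest: symD)
  have cardW: "card ?W = m" using Suc u by simp
  show ?case
  \<comment> \<open>The induction bottoms out at a single vertex, where irreflexivity leaves no
    arcs; the bound fails for the empty set.\<close>
  proof (cases "?W = {}")
    case True
    then have "U = {u}" using u by blast
    then have "R \<inter> U \<times> U = {}" using irrefl by (auto simp: irrefl_def)
    then show ?thesis using \<open>U = {u}\<close> by simp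
  next
    case False
    have fin: "finite ?N" "finite (R \<inter> ?W \<times> ?W)" using Suc.prems by auto
    have "card (R \<inter> U \<times> U) \<le> card (R \<inter> ?W \<times> ?W) + card ({u} \<times> ?N \<union> ?N \<times> {u})"
      using fin by (intro order_trans[OF card_mono[OF _ split] card_Un_le]) auto
    moreover have "card ({u} \<times> ?N \<union> ?N \<times> {u}) \<le> 2"
      using card_Un_le[of "{u} \<times> ?N" "?N \<times> {u}"] u by (simp add: card_cartesian_product)
    moreover have "card (R \<inter> ?W \<times> ?W) + 2 \<le> 2 * card ?W"
      using Suc.prems False cardW by (intro Suc.hyps(1)) auto
    ultimately show ?thesis using Suc.hyps(2) cardW by linarith
  qed
qed

text \<open>
  The branch sets induce at least \<open>\<Sum>x. (|B x| - 1)\<close> edges, and with the edges realising \<open>E\<close>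
  these are at most \<open>(\<Sum>x. |B x|) - 1\<close>; no contraction argument is needed.
\<close>

lemma forest_minor_card_arcs:
  assumes G: "sym (parcs G)" "irrefl (parcs G)"
    and A: "finite A" "A \<noteq> {}"
    and B: "\<And>x. x \<in> A \<Longrightarrow> finite (B x)"
      "\<And>x. x \<in> A \<Longrightarrow> Digraph_Component.connected (with_proj G \<restriction> B x)"
    and disj: "\<And>x y. x \<in> A \<Longrightarrow> y \<in> A \<Longrightarrow> x \<noteq> y \<Longrightarrow> B x \<inter> B y = {}"
    and E: "E \<subseteq> A \<times> A" "irrefl E"
      "\<And>x y. (x, y) \<in> E \<Longrightarrow> \<exists>u\<in>B x. \<exists>v\<in>B y. (u, v) \<in> parcs G"
    and leaf: "\<And>W. W \<subseteq> (\<Union>x\<in>A. B x) \<Longrightarrow> W \<noteq> {} \<Longrightarrow> \<exists>u\<in>W. card {v\<in>W. (u, v) \<in> parcs G} \<le> 1"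
  shows "card E + 2 \<le> 2 * card A"
proof -
  let ?U = "\<Union>x\<in>A. B x"
  let ?I = "\<lambda>x. parcs G \<inter> B x \<times> B x"
  have "B x \<noteq> {}" if "x \<in> A" for x
    using B(2)[OF that] G(1) by (simp add: connected_induce_subgraph_iff)
  then have neU: "?U \<noteq> {}" using A by blast
  have finU: "finite ?U" using A B by blast
  have "\<forall>e\<in>E. \<exists>a\<in>parcs G. fst a \<in> B (fst e) \<and> snd a \<in> B (snd e)"
  proof
    fix e assume "e \<in> E"
    then have "\<exists>u\<in>B (fst e). \<exists>v\<in>B (snd e). (u, v) \<in> parcs G" by (intro E(3)) simp
    then show "\<exists>a\<in>parcs G. fst a \<in> B (fst e) \<and> snd a \<in> B (snd e)" by force
  qed
  then obtain f where f: "\<And>e. e \<in> E \<Longrightarrow> f e \<in> parcs G"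
    "\<And>e. e \<in> E \<Longrightarrow> fst (f e) \<in> B (fst e)" "\<And>e. e \<in> E \<Longrightarrow> snd (f e) \<in> B (snd e)"
    by metis
  have uniq: "x = y" if "x \<in> A" "y \<in> A" "u \<in> B x" "u \<in> B y" for x y u
    using disj that by blast
  have EA: "fst e \<in> A" "snd e \<in> A" if "e \<in> E" for e using E(1) that by auto
  \<comment> \<open>Disjoint branch sets let the endpoints of \<open>f e\<close> determine those of
    \<open>e\<close>.\<close>
  have inj: "inj_on f E"
  proof (rule inj_onI)
    fix d e assume de: "d \<in> E" "e \<in> E" "f d = f e"
    then have "fst d = fst e" "snd d = snd e" using f EA uniq by metis+
    then show "d = e" by (rule prod_eqI)
  qed
  \<comment> \<open>An arc chosen for \<open>e\<close> inside a single branch set would make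
    \<open>e\<close> a loop.\<close>
  have disjE: "f ` E \<inter> (\<Union>x\<in>A. ?I x) = {}"
  proof -
    have False if e: "e \<in> E" "x \<in> A" "f e \<in> ?I x" for e x
    proof -
      have "fst (f e) \<in> B x" "snd (f e) \<in> B x" using e(3) by (auto simp: mem_Times_iff)
      then have "fst e = x" "snd e = x" using f EA uniq e by metis+
      then have "(x, x) \<in> E" using e by (metis prod.collapse)
      then show False using E(2) by (auto simp: irrefl_def)
    qed
    then show ?thesis by (simp only: disjoint_iff image_iff UN_iff) metis
  qed
  have finE: "finite E" using A E(1) finite_subset by blast
  have sumB: "card ?U = (\<Sum>x\<in>A. card (B x))"
    using A B disj by (intro card_UN_disjoint) auto
  \<comment> \<open>With b the total size of the branch sets and i the number of arcs inside them,
    2b \<le> i + 2|A| and |E| + i + 2 \<le> 2b; adding these cancels b and i.\<close>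
  have "(\<Sum>x\<in>A. 2 * card (B x)) \<le> (\<Sum>x\<in>A. card (?I x) + 2)"
    using connected_card_arcs_ge[OF G(1)] B by (intro sum_mono) auto
  moreover have "(\<Sum>x\<in>A. card (?I x)) = card (\<Union>x\<in>A. ?I x)"
  proof (rule card_UN_disjoint[symmetric])
    show "\<forall>x\<in>A. finite (?I x)" using B by simp
    have "?I x \<inter> ?I y \<subseteq> (B x \<inter> B y) \<times> UNIV" for x y by blast
    then show "\<forall>x\<in>A. \<forall>y\<in>A. x \<noteq> y \<longrightarrow> ?I x \<inter> ?I y = {}" using disj by fastforce
  qed (rule A)
  moreover have "card E + card (\<Union>x\<in>A. ?I x) = card (f ` E \<union> (\<Union>x\<in>A. ?I x))"
    using inj disjE finE A B by (subst card_Un_disjoint) (auto simp: card_image)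
  moreover have "\<dots> \<le> card (parcs G \<inter> ?U \<times> ?U)"
  proof (rule card_mono)
    have "f e \<in> parcs G \<inter> ?U \<times> ?U" if "e \<in> E" for e
      using f[OF that] EA[OF that] by (auto simp: mem_Times_iff)
    then show "f ` E \<union> (\<Union>x\<in>A. ?I x) \<subseteq> parcs G \<inter> ?U \<times> ?U" by blast
  qed (use finU in blast)
  moreover have "card (parcs G \<inter> ?U \<times> ?U) + 2 \<le> 2 * card ?U"
    using G finU neU leaf by (rule card_arcs_le_if_leaves)
  moreover have "(\<Sum>x\<in>A. 2 * card (B x)) = 2 * card ?U" by (simp add: sumB sum_distrib_left)
  moreover have "(\<Sum>x\<in>A. card (?I x) + 2) = (\<Sum>x\<in>A. card (?I x)) + 2 * card A"
    by (simp only: sum.distrib) simp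
  ultimately show ?thesis by linarith
qed

section \<open>Grids\<close>

lemma pverts_grid: "pverts (grid k) = {..<k} \<times> {..<k}"
  by (simp add: grid_def cartesian_product_def path_graph_def)

lemma card_parcs_path_graph: "card (parcs (path_graph k)) = 2 * (k - 1)"
proof -
  have "parcs (path_graph k) = (\<lambda>i. (i, Suc i)) ` {..<k - 1} \<union> (\<lambda>i. (Suc i, i)) ` {..<k - 1}"
    by (auto simp: path_graph_def image_iff)
  then show ?thesis
    by (simp add: card_Un_disjoint card_image inj_on_def disjoint_iff image_iff)
qed

lemma card_parcs_cartesian_product:
  assumes "pair_graph G" "pair_graph H"
  shows "card (parcs (cartesian_product G H)) =
    card (pverts G) * card (parcs H) + card (parcs G) * card (pverts H)"
proof -
  interpret G: pair_graph G by fact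
  interpret H: pair_graph H by fact
  \<comment> \<open>The two maps list the arcs within copies of \<open>H\<close> and within copies
    of \<open>G\<close>. A common arc would be a loop.\<close>
  let ?f = "\<lambda>(u, (v, w)). ((u, v), (u, w))" and ?g = "\<lambda>((u, v), w). ((u, w), (v, w))"
  have "parcs (cartesian_product G H) = ?f ` (pverts G \<times> parcs H) \<union> ?g ` (parcs G \<times> pverts H)"
    by (force simp: cartesian_product_def)
  moreover have "?f ` (pverts G \<times> parcs H) \<inter> ?g ` (parcs G \<times> pverts H) = {}"
    using assms by (auto simp: pair_graph_iff irrefl_def)
  moreover have "inj_on ?f (pverts G \<times> parcs H)" "inj_on ?g (parcs G \<times> pverts H)"
    by (auto simp: inj_on_def)
  ultimately show ?thesis
    by (simp add: card_Un_disjoint card_image card_cartesian_product)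
qed

lemma card_parcs_grid: "card (parcs (grid k)) = 4 * (k * (k - 1))"
proof -
  have "pair_graph (path_graph k)"
    by (auto simp: pair_graph_iff path_graph_def intro!: symI irreflI)
  moreover have "card (pverts (path_graph k)) = k" by (simp add: path_graph_def)
  ultimately show ?thesis
    by (simp add: grid_def card_parcs_cartesian_product card_parcs_path_graph)
qed

lemma card_grid_neighbours_le: "card {y. (x, y) \<in> parcs (grid k)} \<le> 4"
proof -
  obtain i j where x: "x = (i, j)" by (cases x)
  \<comment> \<open>At the border, entries may lie outside the grid or, by truncated subtraction,
    repeat \<open>x\<close>; only an upper bound is wanted.\<close>
  have "{y. (x, y) \<in> parcs (grid k)} \<subseteq> set [(Suc i, j), (i - 1, j), (i, Suc j), (i, j - 1)]"
    by (auto simp: x grid_def cartesian_product_def path_graph_def)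
  then have "card {y. (x, y) \<in> parcs (grid k)} \<le>
      card (set [(Suc i, j), (i - 1, j), (i, Suc j), (i, j - 1)])"
    by (intro card_mono) auto
  also have "\<dots> \<le> 4" using card_length[of "[(Suc i, j), (i - 1, j), (i, Suc j), (i, j - 1)]"]
    by simp
  finally show ?thesis .
qed

lemma card_parcs_grid_delete:
  assumes X: "X \<subseteq> pverts (grid k)"
  shows "4 * (k * (k - 1)) \<le>
    card (parcs (grid k) \<inter> (pverts (grid k) - X) \<times> (pverts (grid k) - X)) + 8 * card X"
proof -
  interpret pair_graph "grid k" by (rule pair_graph_grid)
  let ?E = "parcs (grid k)" and ?A = "pverts (grid k) - X"
  \<comment> \<open>Every lost arc has its tail in \<open>X\<close>, hence lies in
    \<open>?O\<close>, or its head in \<open>X\<close>, hence lies in the swapped copy. Each of the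
    two has at most 4|X| arcs.\<close>
  let ?O = "SIGMA x:X. {y. (x, y) \<in> ?E}"
  have finX: "finite X" by (rule finite_subset[OF X pair_finite_verts])
  have finN: "finite {y. (x, y) \<in> ?E}" for x
    by (rule finite_subset[of _ "pverts (grid k)"]) (auto dest: in_arcsD2)
  have "?E \<subseteq> (?E \<inter> ?A \<times> ?A) \<union> (?O \<union> prod.swap ` ?O)"
  proof (rule subrelI)
    fix x y assume xy: "(x, y) \<in> ?E"
    then have "x \<in> pverts (grid k)" "y \<in> pverts (grid k)" "(y, x) \<in> ?E"
      by (auto dest: in_arcsD1 in_arcsD2 arcs_symmetric)
    then show "(x, y) \<in> (?E \<inter> ?A \<times> ?A) \<union> (?O \<union> prod.swap ` ?O)"
      using xy by (auto simp: image_iff)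
  qed
  then have "card ?E \<le> card ((?E \<inter> ?A \<times> ?A) \<union> (?O \<union> prod.swap ` ?O))"
    using finX finN by (intro card_mono) (auto intro!: finite_SigmaI)
  also have "\<dots> \<le> card (?E \<inter> ?A \<times> ?A) + (card ?O + card (prod.swap ` ?O))"
    using card_Un_le[of "?E \<inter> ?A \<times> ?A" "?O \<union> prod.swap ` ?O"]
      card_Un_le[of ?O "prod.swap ` ?O"] by linarith
  also have "card (prod.swap ` ?O) = card ?O" by (simp add: card_image)
  also have "card ?O \<le> 4 * card X"
    using sum_mono[of X "\<lambda>x. card {y. (x, y) \<in> ?E}" "\<lambda>_. 4"] card_grid_neighbours_le finX finN
    by (simp add: card_SigmaI)
  finally show ?thesis by (simp add: card_parcs_grid)
qed

section \<open>Monotonicity of the largest grid minor\<close>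

text \<open>The same branch sets serve: extra arcs destroy neither connectedness inside a branch set
  nor adjacency between two.\<close>

lemma is_minor_spanning_mono:
  assumes "sym (parcs G)" "sym (parcs G')"
    and "pverts G \<subseteq> pverts G'" "parcs G \<subseteq> parcs G'" "is_minor H G"
  shows "is_minor H G'"
proof -
  obtain B where B: "minor_model H G B" using assms(5) by (auto simp: is_minor_def)
  have "(u, v) \<in> rtrancl_on C (parcs G' \<inter> C \<times> C)"
    if "(u, v) \<in> rtrancl_on C (parcs G \<inter> C \<times> C)" for u v C
    using that by (rule rtrancl_on_mono[rotated 2]) (use assms(4) in auto)
  then have "Digraph_Component.connected (with_proj G' \<restriction> C)"
    if "Digraph_Component.connected (with_proj G \<restriction> C)" for C
    using that assms(1,2) by (auto simp: connected_induce_subgraph_iff)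
  moreover have "\<exists>u\<in>B x. \<exists>v\<in>B y. (u, v) \<in> parcs G'" if "(x, y) \<in> parcs H" for x y
  proof -
    have "\<exists>u\<in>B x. \<exists>v\<in>B y. (u, v) \<in> parcs G" using B that by (auto simp: minor_model_def)
    then show ?thesis using assms(4) by blast
  qed
  moreover have "B x \<subseteq> pverts G'" if "x \<in> pverts H" for x
    using B assms(3) that by (auto simp: minor_model_def)
  ultimately have "minor_model H G' B"
    using B by (simp add: minor_model_def split_beta)
  then show ?thesis by (auto simp: is_minor_def)
qed

lemma gm_mono:
  assumes "pair_graph G" "pair_graph G'" "pverts G \<subseteq> pverts G'" "parcs G \<subseteq> parcs G'"
  shows "gm G \<le> gm G'"
proof (rule gm_ge)
  show "finite (pverts G')" using assms by (simp add: pair_graph_iff)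
  have "is_minor (grid (gm G)) G" using assms by (intro is_minor_grid_gm) (simp add: pair_graph_iff)
  then show "is_minor (grid (gm G)) G'"
    using assms by (intro is_minor_spanning_mono[of G G']) (simp_all add: pair_graph_iff)
qed

section \<open>Grid minors of a star times a tree\<close>

text \<open>Without its centre the star has no arcs, so the product falls apart into copies of
  \<open>T\<close>. A leaf of one nonempty slice of \<open>W\<close> is a leaf of
  \<open>W\<close>.\<close>

lemma leaf_in_lexicographic_star_without_centre:
  assumes S: "parcs S = {c} \<times> (pverts S - {c}) \<union> (pverts S - {c}) \<times> {c}"
    and T: "undirected_tree T"
    and W: "W \<subseteq> (pverts S - {c}) \<times> pverts T" "W \<noteq> {}"
  shows "\<exists>u\<in>W. card {v\<in>W. (u, v) \<in> parcs (lexicographic_product S T)} \<le> 1"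
proof -
  obtain l w where lw: "(l, w) \<in> W" using W by auto
  let ?U = "{w. (l, w) \<in> W}"
  have finT: "finite (pverts T)" using T by (auto simp: undirected_tree_def pair_graph_iff)
  have U: "?U \<subseteq> pverts T" "?U \<noteq> {}" using W lw by auto
  then obtain u where u: "u \<in> ?U" "card {v\<in>?U. (u, v) \<in> parcs T} \<le> 1"
    using acyclic_ex_leaf[of T ?U] T by (auto simp: undirected_tree_def)
  have "{v\<in>W. ((l, u), v) \<in> parcs (lexicographic_product S T)} \<subseteq>
      Pair l ` {v\<in>?U. (u, v) \<in> parcs T}"
    using W lw by (auto simp: lexicographic_product_def S)
  moreover have "finite {v\<in>?U. (u, v) \<in> parcs T}"
    using U(1) finT finite_subset[of ?U] by auto
  ultimately have "card {v\<in>W. ((l, u), v) \<in> parcs (lexicographic_product S T)} \<le>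
      card {v\<in>?U. (u, v) \<in> parcs T}"
    by (meson card_image_le card_mono finite_imageI order_trans)
  then show ?thesis using u by (intro bexI[of _ "(l, u)"]) auto
qed

lemma grid_minor_lexicographic_star_tree:
  assumes S: "star S" and T: "undirected_tree T"
    and minor: "is_minor (grid k) (lexicographic_product S T)" and k: "0 < k"
  shows "(real k - 1)\<^sup>2 \<le> 3 * real (card (pverts T))"
proof -
  let ?G = "lexicographic_product S T" and ?V = "pverts (grid k)" and ?E = "parcs (grid k)"
  obtain c where c: "parcs S = {c} \<times> (pverts S - {c}) \<union> (pverts S - {c}) \<times> {c}"
    and pS: "pair_graph S"
    using S by (auto simp: star_def)
  have pT: "pair_graph T" using T by (simp add: undirected_tree_def)
  have G: "finite (pverts ?G)" "sym (parcs ?G)" "irrefl (parcs ?G)"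
    using pair_graph_lexicographic_product[OF pS pT] by (auto simp: pair_graph_iff)
  have finT: "finite (pverts T)" using pT by (simp add: pair_graph_iff)
  obtain B where B: "minor_model (grid k) ?G B" using minor by (auto simp: is_minor_def)
  have Bsub: "B x \<subseteq> pverts S \<times> pverts T" if "x \<in> ?V" for x
    using B that by (auto simp: minor_model_def lexicographic_product_def)
  have disj: "B x \<inter> B y = {}" if "x \<in> ?V" "y \<in> ?V" "x \<noteq> y" for x y
    using B that by (simp add: minor_model_def)
  define X where "X = {x\<in>?V. \<exists>w. (c, w) \<in> B x}"
  define A where "A = ?V - X"
  have finV: "finite ?V" and cardV: "card ?V = k * k"
    by (simp_all add: pverts_grid card_cartesian_product)
  have XV: "X \<subseteq> ?V" by (auto simp: X_def)
  have cardA: "card A + card X = k * k"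
    using card_Diff_subset[of X ?V] card_mono[OF finV XV] finite_subset[OF XV finV] XV
    by (simp add: A_def cardV)
  have "card X \<le> card (pverts T)"
  proof -
    have "\<forall>x\<in>X. \<exists>w. (c, w) \<in> B x" by (simp add: X_def)
    then obtain f where f: "\<And>x. x \<in> X \<Longrightarrow> (c, f x) \<in> B x" by metis
    \<comment> \<open>The chosen vertices share the first coordinate \<open>c\<close>, so equal
      second coordinates would put one vertex into two disjoint branch sets.\<close>
    have "inj_on f X"
    proof (rule inj_onI, rule ccontr)
      fix x y assume xy: "x \<in> X" "y \<in> X" "f x = f y" "x \<noteq> y"
      then have "B x \<inter> B y = {}" using disj XV by blast
      then show False using f[OF xy(1)] f[OF xy(2)] xy(3) by auto
    qed
    moreover have "f ` X \<subseteq> pverts T" using f Bsub XV by blast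
    ultimately show ?thesis using finT by (rule card_inj_on_le)
  qed
  \<comment> \<open>This bound by \<open>card X\<close> needs \<open>0 < k\<close>: at k = 0 it
    would read 1 \<le> 0. The case split is there because the forest bound requires a remaining
    branch set.\<close>
  moreover have "(real k - 1)\<^sup>2 \<le> 3 * real (card X)"
  proof (cases "A = {}")
    case True
    then have "real (card X) = (real k)\<^sup>2" using cardA by (simp add: power2_eq_square flip: of_nat_mult)
    moreover have "(real k - 1)\<^sup>2 \<le> (real k)\<^sup>2" using k by (intro power_mono) auto
    ultimately show ?thesis by (smt (verit) zero_le_power2)
  next
    case False
    have leaves: "(\<Union>x\<in>A. B x) \<subseteq> (pverts S - {c}) \<times> pverts T"
      using Bsub by (fastforce simp: A_def X_def)
    have "card (?E \<inter> A \<times> A) + 2 \<le> 2 * card A"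
    proof (rule forest_minor_card_arcs[OF G(2,3), where B = B])
      show "finite A" "A \<noteq> {}" using finV False by (auto simp: A_def)
      show "finite (B x)" if "x \<in> A" for x
        using that B G(1) by (auto simp: A_def minor_model_def intro: finite_subset)
      show "Digraph_Component.connected (with_proj ?G \<restriction> B x)" if "x \<in> A" for x
        using that B by (auto simp: A_def minor_model_def)
      show "B x \<inter> B y = {}" if "x \<in> A" "y \<in> A" "x \<noteq> y" for x y
        using that disj by (auto simp: A_def)
      show "irrefl (?E \<inter> A \<times> A)"
        using pair_graph_grid[of k] by (auto simp: pair_graph_iff irrefl_def)
      show "\<exists>u\<in>B x. \<exists>v\<in>B y. (u, v) \<in> parcs ?G" if "(x, y) \<in> ?E \<inter> A \<times> A" for x y
        using that B by (auto simp: minor_model_def)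
      show "\<exists>u\<in>W. card {v\<in>W. (u, v) \<in> parcs ?G} \<le> 1"
        if "W \<subseteq> (\<Union>x\<in>A. B x)" "W \<noteq> {}" for W
        using leaf_in_lexicographic_star_without_centre[OF c T] that leaves by blast
    qed auto
    moreover have "4 * (k * (k - 1)) \<le> card (?E \<inter> A \<times> A) + 8 * card X"
      using card_parcs_grid_delete[OF XV] by (simp add: A_def)
    \<comment> \<open>The \<open>+ 2\<close> of the forest bound completes the square: replacing
      \<open>card A\<close> by k*k - |X| leaves twice the square of k - 1 on the left and 6|X| on
      the right.\<close>
    ultimately have "4 * (k * (k - 1)) + 2 \<le> 2 * card A + 8 * card X" by linarith
    then have "4 * (k * (k - 1)) + 2 \<le> 2 * (k * k) + 6 * card X" using cardA by linarith
    then have "real (4 * (k * (k - 1)) + 2) \<le> real (2 * (k * k) + 6 * card X)"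
      by (rule of_nat_mono)
    \<comment> \<open>Truncation of \<open>k - 1\<close> at 0 is harmless, since the factor
      \<open>k\<close> vanishes there too.\<close>
    moreover have "real (k * (k - 1)) = real k * real k - real k"
      by (cases k) (auto simp: algebra_simps)
    ultimately show ?thesis by (simp add: power2_eq_square algebra_simps)
  qed
  ultimately show ?thesis by linarith
qed

theorem theorem11:
  fixes S :: "'a pair_pre_digraph" and T :: "'b pair_pre_digraph" and n :: nat
  assumes "star S" and "undirected_tree T" and "card (pverts T) = n"
  shows "gm (cartesian_product S T) \<le> gm (strong_product S T) \<and>
    gm (strong_product S T) \<le> gm (lexicographic_product S T) \<and>
    real (gm (lexicographic_product S T)) < sqrt (3 * real n + 1) + 1"
proof -
  have ST: "pair_graph S" "pair_graph T"
    using assms by (auto simp: star_def undirected_tree_def)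
  note products = pair_graph_cartesian_product[OF ST] pair_graph_strong_product[OF ST]
    pair_graph_lexicographic_product[OF ST]
  have "gm (cartesian_product S T) \<le> gm (strong_product S T)"
    using products(1,2)
    by (rule gm_mono) (auto simp: cartesian_product_def strong_product_def)
  moreover have "gm (strong_product S T) \<le> gm (lexicographic_product S T)"
    using products(2,3)
  proof (rule gm_mono)
    \<comment> \<open>Once the first coordinates are adjacent, any second coordinates in
      \<open>pverts T\<close> will do; endpoints of arcs of \<open>T\<close> lie there.\<close>
    show "parcs (strong_product S T) \<subseteq> parcs (lexicographic_product S T)"
      using ST(2) by (auto simp: strong_product_def lexicographic_product_def pair_graph_iff)
  qed (auto simp: strong_product_def lexicographic_product_def)
  moreover have "real (gm (lexicographic_product S T)) < sqrt (3 * real n + 1) + 1"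
  proof (cases "gm (lexicographic_product S T)")
    case 0
    have "0 \<le> sqrt (3 * real n + 1)" by simp
    then have "0 < sqrt (3 * real n + 1) + 1" by linarith
    then show ?thesis using 0 by simp
  next
    case (Suc m)
    let ?k = "gm (lexicographic_product S T)"
    have "is_minor (grid ?k) (lexicographic_product S T)"
      using products(3) by (intro is_minor_grid_gm) (simp add: pair_graph_iff)
    then have "(real ?k - 1)\<^sup>2 \<le> 3 * real n"
      using grid_minor_lexicographic_star_tree[OF assms(1,2), of ?k] assms(3) Suc by simp
    \<comment> \<open>Strictness comes from 3n < 3n + 1 under the root.\<close>
    then have "real ?k - 1 < sqrt (3 * real n + 1)" by (intro real_less_rsqrt) simp
    then show ?thesis by simp
  qed
  ultimately show ?thesis by blast
qed

end
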